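(* $$-\frac{64}{\pi^2} = \sum_{k=0}^{\infty}\left(-\frac14\right)^{k}\frac{\left(\frac32\right)_k^5}{(1)_k^4\,(2)_k}\,\big(20k^2+24k+9\big).$$
   Context: The Pochhammer symbol is $(x)_k := \frac{\Gamma(x+k)}{\Gamma(x)}$, i.e. $(x)_k = x(x+1)\cdots(x+k-1)$ for integers $k\ge 0$; $(x)_k^m$ means $\big((x)_k\big)^m$. *)

theory Defs
  imports "HOL-Analysis.Analysis"
begin

end

theory Submission
  imports Defs "HOL-Real_Asymp.Real_Asymp"
begin

text \<open>
  The series is, up to a telescoping correction, Guillera's series
  \<open>\<Sum> u\<^sub>n (20 n\<^sup>2 + 8 n + 1) = 8 / \<pi>\<^sup>2\<close> with \<open>u\<^sub>n = (-1/4)\<^sup>n ((1/2)\<^sub>n / n!)\<^sup>5\<close>.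
  Since \<open>(3/2)\<^sub>k = 2 (1/2)\<^sub>k\<^sub>+\<^sub>1\<close>, its \<open>k\<close>-th term is \<open>- 128 u\<^sub>n n\<^sup>4 (20 n\<^sup>2 - 16 n + 5)\<close> at
  \<open>n = k + 1\<close>, and \<open>16 u\<^sub>n n\<^sup>4 (20 n\<^sup>2 - 16 n + 5)\<close> differs from \<open>u\<^sub>n (20 n\<^sup>2 + 8 n + 1)\<close> by
  \<open>h(n+1) - h(n)\<close> for a null sequence \<open>h\<close> with \<open>h(0) = 0\<close> (lemma \<open>shifted_term\<close>).

  Guillera's series is summed by the Wilf-Zeilberger method. One embeds \<open>u\<^sub>n\<close> as the case \<open>k = 0\<close> of
  \[ B(n,k) = (-1/4)^n \frac{(1/2)_n^5 \, (1/2)_k^4}{n! \, (n+k)!^4} \]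
  and multiplies by suitable polynomials to get a pair \<open>F\<close>, \<open>G\<close> with
  \<open>F(n,k+1) - F(n,k) = G(n+1,k) - G(n,k)\<close> (lemma \<open>wz_pair\<close>). As \<open>G\<close> vanishes at \<open>n = 0\<close> and in
  the limit \<open>n \<rightarrow> \<infinity>\<close>, the sum \<open>\<Sum>\<^sub>n F(n,k)\<close> is the same for every \<open>k\<close>. For \<open>k \<rightarrow> \<infinity>\<close> all terms
  with \<open>n \<ge> 1\<close> together are \<open>O(1/k\<^sup>2)\<close>, and Wallis' product gives \<open>F(0,k) \<rightarrow> 8 / \<pi>\<^sup>2\<close>.
\<close>

section \<open>A Wilf-Zeilberger pair\<close>

definition wz_kernel :: "nat \<Rightarrow> nat \<Rightarrow> real" where
  "wz_kernel n k = (- (1 / 4)) ^ n * (pochhammer (1 / 2) n ^ 5 * pochhammer (1 / 2) k ^ 4)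
                   / (fact n * fact (n + k) ^ 4)"

definition wz_F :: "nat \<Rightarrow> nat \<Rightarrow> real" where
  "wz_F n k = wz_kernel n k *
     (20 * real n ^ 2 + 8 * real n + 1 + 24 * real k * real n + 8 * real k ^ 2 + 4 * real k)"

definition wz_G :: "nat \<Rightarrow> nat \<Rightarrow> real" where
  "wz_G n k = wz_kernel n k * (8 * real n * (2 * real n + 4 * real k + 1))"

lemma wz_kernel_Suc_left:
  "wz_kernel (Suc n) k = wz_kernel n k *
     (- ((real n + 1 / 2) ^ 5) / (4 * ((real n + 1) * (real n + real k + 1) ^ 4)))"
  by (simp add: wz_kernel_def pochhammer_Suc power_mult_distrib add_ac divide_simps)

lemma wz_kernel_Suc_right:
  "wz_kernel n (Suc k) = wz_kernel n k * ((real k + 1 / 2) ^ 4 / (real n + real k + 1) ^ 4)"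
  by (simp add: wz_kernel_def pochhammer_Suc power_mult_distrib add_ac divide_simps)

text \<open>All four values are rational multiples of \<open>B(n,k)\<close>, so after division by it and multiplication by
  \<open>(n + k + 1)\<^sup>4\<close> the claim is an identity of polynomials in \<open>n\<close> and \<open>k\<close>. With the factor \<open>n\<close> that
  makes \<open>G(0,k)\<close> vanish imposed, comparing coefficients in this identity determines the polynomial
  of \<open>G\<close> from that of \<open>F\<close>.\<close>

lemma wz_pair: "wz_F n (Suc k) - wz_F n k = wz_G (Suc n) k - wz_G n k"
proof -
  define x where "x = real n"
  define y where "y = real k"
  have nz: "x + 1 \<noteq> 0" "x + y + 1 \<noteq> 0"
    unfolding x_def y_def by linarith+
  have cleared: "(y + 1 / 2) ^ 4 * (20 * x\<^sup>2 + 8 * x + 1 + 24 * (y + 1) * x + 8 * (y + 1)\<^sup>2 + 4 * (y + 1))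
          - (x + y + 1) ^ 4 * (20 * x\<^sup>2 + 8 * x + 1 + 24 * y * x + 8 * y\<^sup>2 + 4 * y)
        = - ((x + 1 / 2) ^ 5) / 4 * (8 * (2 * (x + 1) + 4 * y + 1))
          - (x + y + 1) ^ 4 * (8 * x * (2 * x + 4 * y + 1))"
    by algebra
  have divide: "c / e * p - p' = - s / (4 * (m * e)) * (m * q) - q'"
    if "c * p - e * p' = - s / 4 * q - e * q'" "m \<noteq> 0" "e \<noteq> 0" for c e p p' s m q q' :: real
  proof -
    have "c / e * p - p' = (c * p - e * p') / e"
      using that(3) by (simp add: diff_divide_distrib)
    also have "\<dots> = (- s / 4 * q - e * q') / e"
      by (simp only: that(1))
    also have "\<dots> = - s / (4 * (m * e)) * (m * q) - q'"
      using that(2,3) by (simp add: diff_divide_distrib)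
    finally show ?thesis .
  qed
  have "(y + 1 / 2) ^ 4 / (x + y + 1) ^ 4 *
            (20 * x\<^sup>2 + 8 * x + 1 + 24 * (y + 1) * x + 8 * (y + 1)\<^sup>2 + 4 * (y + 1))
          - (20 * x\<^sup>2 + 8 * x + 1 + 24 * y * x + 8 * y\<^sup>2 + 4 * y)
        = - ((x + 1 / 2) ^ 5) / (4 * ((x + 1) * (x + y + 1) ^ 4)) *
            ((x + 1) * (8 * (2 * (x + 1) + 4 * y + 1)))
          - 8 * x * (2 * x + 4 * y + 1)" (is "?l1 - ?l2 = ?r1 - ?r2")
    using nz by (intro divide[OF cleared]) auto
  hence "wz_kernel n k * (?l1 - ?l2) = wz_kernel n k * (?r1 - ?r2)"
    by (rule arg_cong)
  moreover have "wz_F n (Suc k) = wz_kernel n k * ?l1" "wz_F n k = wz_kernel n k * ?l2"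
    by (simp_all only: wz_F_def wz_kernel_Suc_right x_def y_def of_nat_Suc add.commute[of 1] mult.assoc)
  moreover have "wz_G (Suc n) k = wz_kernel n k * ?r1" "wz_G n k = wz_kernel n k * ?r2"
    by (simp_all only: wz_G_def wz_kernel_Suc_left x_def y_def of_nat_Suc add.commute[of 1]
          mult.assoc mult.left_commute[of 8])
  ultimately show ?thesis
    by (simp only: right_diff_distrib)
qed

section \<open>Bounds\<close>

lemma pochhammer_half_le_fact: "pochhammer (1 / 2) n \<le> (fact n :: real)"
proof (induction n)
  case (Suc n)
  have "pochhammer (1 / 2) n * (1 / 2 + real n) \<le> fact n * (1 + real n)"
    using Suc by (intro mult_mono) auto
  thus ?case by (simp add: pochhammer_Suc mult_ac)
qed simp

text \<open>The estimate \<open>(1/2)\<^sub>m \<le> m!\<close> cancels all but one binomial coefficient from each of the four factors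
  \<open>(1/2)\<^sub>n (1/2)\<^sub>k / (n+k)!\<close>, which is what makes the sum over \<open>n\<close> concentrate at \<open>n = 0\<close> for large \<open>k\<close>.\<close>

lemma wz_kernel_bound:
  "\<bar>wz_kernel n k\<bar> \<le> (1 / 4) ^ n * (1 / real ((n + k) choose n)) ^ 4"
proof -
  let ?a = "\<lambda>n. pochhammer (1 / 2) n :: real"
  have pos: "?a m \<ge> 0" for m by (simp add: pochhammer_nonneg)
  have "?a n * ?a k \<le> fact n * fact k"
    using pos by (intro mult_mono pochhammer_half_le_fact) auto
  hence "?a n * ?a k / fact (n + k) \<le> fact n * fact k / fact (n + k)"
    by (simp add: divide_right_mono)
  also have "\<dots> = 1 / real ((n + k) choose n)"
    by (simp add: binomial_fact)
  finally have 1: "?a n * ?a k / fact (n + k) \<le> 1 / real ((n + k) choose n)" .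
  have 2: "?a n / fact n \<le> 1"
    by (simp add: pochhammer_half_le_fact)
  have "\<bar>wz_kernel n k\<bar> = (1 / 4) ^ n * ((?a n / fact n) * (?a n * ?a k / fact (n + k)) ^ 4)"
    using pos by (simp add: wz_kernel_def abs_mult power_abs eval_nat_numeral power_mult_distrib)
  also have "\<dots> \<le> (1 / 4) ^ n * (1 * (1 / real ((n + k) choose n)) ^ 4)"
    using pos 1 2 by (intro mult_left_mono mult_mono power_mono) auto
  finally show ?thesis by simp
qed

lemma wz_kernel_le_power: "\<bar>wz_kernel n k\<bar> \<le> (1 / 4) ^ n"
proof -
  have "real ((n + k) choose n) \<ge> 1"
    by (simp add: Suc_leI)
  hence "(1 / real ((n + k) choose n)) ^ 4 \<le> 1"
    by (intro power_le_one) auto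
  hence "(1 / 4) ^ n * (1 / real ((n + k) choose n)) ^ 4 \<le> (1 / 4) ^ n * 1"
    by (intro mult_left_mono) auto
  with wz_kernel_bound[of n k] show ?thesis by linarith
qed

lemma square_le_power2: "(real n + 1)\<^sup>2 \<le> 4 * 2 ^ n"
proof (induction n)
  case (Suc n)
  show ?case
  proof (cases "n \<le> 1")
    case True
    thus ?thesis by (cases n) auto
  next
    case False
    hence "real n * real n \<ge> 2 * 1" by (intro mult_mono) auto
    thus ?thesis using Suc by (simp add: power2_eq_square algebra_simps)
  qed
qed simp

lemma wz_F_poly_bound:
  "(1 / 4) ^ n * (20 * real n ^ 2 + 8 * real n + 1 + 24 * real k * real n + 8 * real k ^ 2 + 4 * real k)
     \<le> 80 * (real k + 1)\<^sup>2 * (1 / 2) ^ n" (is "_ * ?P \<le> _")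
proof -
  have "?P \<le> 20 * (real n + real k + 1)\<^sup>2"
    by (simp add: power2_eq_square algebra_simps)
  also have "\<dots> \<le> 20 * ((real n + 1) * (real k + 1))\<^sup>2"
    by (intro mult_left_mono power_mono) (auto simp: algebra_simps)
  also have "\<dots> = 20 * (real k + 1)\<^sup>2 * (real n + 1)\<^sup>2"
    by (simp add: power_mult_distrib)
  also have "\<dots> \<le> 20 * (real k + 1)\<^sup>2 * (4 * 2 ^ n)"
    by (intro mult_left_mono square_le_power2) auto
  finally have "(1 / 4) ^ n * ?P \<le> (1 / 4) ^ n * (80 * (real k + 1)\<^sup>2 * 2 ^ n)"
    by (intro mult_left_mono) auto
  also have "(1 / 4 :: real) ^ n * (80 * (real k + 1)\<^sup>2 * 2 ^ n)
              = 80 * (real k + 1)\<^sup>2 * ((1 / 4) ^ n * 2 ^ n)" by simp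
  also have "(1 / 4 :: real) ^ n * 2 ^ n = (1 / 2) ^ n"
    by (simp flip: power_mult_distrib)
  finally show ?thesis .
qed

lemma wz_F_bound: "\<bar>wz_F n k\<bar> \<le> 80 * (real k + 1)\<^sup>2 * (1 / 2) ^ n"
proof -
  have "\<bar>wz_F n k\<bar> \<le> (1 / 4) ^ n *
      (20 * real n ^ 2 + 8 * real n + 1 + 24 * real k * real n + 8 * real k ^ 2 + 4 * real k)"
    unfolding wz_F_def abs_mult by (intro mult_mono wz_kernel_le_power) auto
  with wz_F_poly_bound[of n k] show ?thesis by linarith
qed

text \<open>For \<open>n \<ge> 1\<close> the binomial coefficient in the bound of the kernel is at least \<open>k + 1\<close>; its
  fourth power beats the quadratic growth of the polynomial factor in \<open>k\<close>.\<close>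

lemma wz_F_Suc_bound: "\<bar>wz_F (Suc n) k\<bar> \<le> 80 / (real k + 1)\<^sup>2 * (1 / 2) ^ Suc n"
proof -
  let ?N = "Suc n"
  let ?P = "20 * real ?N ^ 2 + 8 * real ?N + 1 + 24 * real k * real ?N + 8 * real k ^ 2 + 4 * real k"
  have "Suc k \<le> (?N + k) choose ?N"
  proof (induction k)
    case (Suc k)
    have "1 \<le> (n + Suc k) choose n" by (simp add: Suc_leI)
    moreover have "(?N + Suc k) choose ?N = ((n + Suc k) choose n) + ((?N + k) choose ?N)" by simp
    ultimately show ?case using Suc by linarith
  qed simp
  hence "real k + 1 \<le> real ((?N + k) choose ?N)"
    by linarith
  hence "(1 / real ((?N + k) choose ?N)) ^ 4 \<le> (1 / (real k + 1)) ^ 4"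
    by (intro power_mono divide_left_mono) auto
  hence "(1 / 4) ^ ?N * (1 / real ((?N + k) choose ?N)) ^ 4 \<le> (1 / 4) ^ ?N * (1 / (real k + 1)) ^ 4"
    by (intro mult_left_mono) auto
  with wz_kernel_bound[of ?N k]
  have ker: "\<bar>wz_kernel ?N k\<bar> \<le> (1 / 4) ^ ?N * (1 / (real k + 1)) ^ 4" by linarith
  have "\<bar>wz_F ?N k\<bar> \<le> ((1 / 4) ^ ?N * (1 / (real k + 1)) ^ 4) * ?P"
    unfolding wz_F_def abs_mult by (intro mult_mono ker) auto
  also have "\<dots> = (1 / (real k + 1)) ^ 4 * ((1 / 4) ^ ?N * ?P)"
    by (simp only: mult_ac)
  also have "\<dots> \<le> (1 / (real k + 1)) ^ 4 * (80 * (real k + 1)\<^sup>2 * (1 / 2) ^ ?N)"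
    by (intro mult_left_mono wz_F_poly_bound) auto
  also have "\<dots> = 80 / (real k + 1)\<^sup>2 * (1 / 2) ^ ?N"
    by (simp add: power_divide divide_simps eval_nat_numeral add_eq_0_iff)
  finally show ?thesis .
qed

section \<open>Guillera's series\<close>

lemma summable_wz_F: "summable (\<lambda>n. wz_F n k)"
proof (rule summable_comparison_test')
  show "summable (\<lambda>n. 80 * (real k + 1)\<^sup>2 * (1 / 2) ^ n)"
    by (intro summable_mult summable_geometric) auto
qed (use wz_F_bound in auto)

lemma wz_G_tendsto_0: "(\<lambda>n. wz_G n k) \<longlonglongrightarrow> 0"
proof (rule Lim_null_comparison)
  define c where "c = real k"
  show "(\<lambda>n. (1 / 4) ^ n * (8 * real n * (2 * real n + 4 * real k + 1))) \<longlonglongrightarrow> 0"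
    unfolding c_def [symmetric] by real_asymp
  show "eventually (\<lambda>n. norm (wz_G n k) \<le> (1 / 4) ^ n * (8 * real n * (2 * real n + 4 * real k + 1)))
          sequentially"
    unfolding wz_G_def real_norm_def abs_mult
    by (intro always_eventually allI mult_mono wz_kernel_le_power) auto
qed

lemma suminf_wz_F: "(\<Sum>n. wz_F n k) = (\<Sum>n. wz_F n 0)"
proof (induction k)
  case (Suc k)
  have "(\<lambda>n. wz_F n (Suc k) - wz_F n k) sums (0 - wz_G 0 k)"
    unfolding wz_pair by (rule telescope_sums[OF wz_G_tendsto_0])
  hence "(\<Sum>n. wz_F n (Suc k) - wz_F n k) = 0"
    by (simp add: sums_iff wz_G_def)
  with Suc show ?case
    by (simp add: suminf_diff[OF summable_wz_F summable_wz_F, symmetric])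
qed simp

lemma wallis_product_pochhammer:
  "(\<Prod>j=1..n. (4 * real j ^ 2) / (4 * real j ^ 2 - 1))
     = 1 / ((pochhammer (1 / 2) n / fact n)\<^sup>2 * (2 * real n + 1))"
proof (induction n)
  case (Suc n)
  have nz: "pochhammer (1 / 2 :: real) n \<noteq> 0"
    using pochhammer_pos[of "1 / 2 :: real" n] by simp
  have *: "4 * real (Suc n) ^ 2 - 1 = (2 * real n + 1) * (2 * real n + 3)"
    by (simp add: power2_eq_square algebra_simps)
  have **: "pochhammer (1 / 2) (Suc n) = pochhammer (1 / 2 :: real) n * ((2 * real n + 1) / 2)"
    by (simp add: pochhammer_Suc algebra_simps)
  have nz': "2 * real n + 1 \<noteq> 0" "2 * real n + 3 \<noteq> 0" "real n + 1 \<noteq> 0" by linarith+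
  have "(\<Prod>j=1..Suc n. (4 * real j ^ 2) / (4 * real j ^ 2 - 1))
      = 1 / ((pochhammer (1 / 2) n / fact n)\<^sup>2 * (2 * real n + 1))
          * (4 * (real n + 1)\<^sup>2 / ((2 * real n + 1) * (2 * real n + 3)))"
    using Suc * by (simp add: add_ac)
  also have "\<dots> = 1 / ((pochhammer (1 / 2) (Suc n) / fact (Suc n))\<^sup>2 * (2 * real (Suc n) + 1))"
    unfolding ** using nz nz'
    by (simp add: power_divide power_mult_distrib add_ac) (simp add: divide_simps power2_eq_square)
  finally show ?case .
qed simp

lemma wz_F_0_tendsto: "(\<lambda>k. wz_F 0 k) \<longlonglongrightarrow> 8 / pi\<^sup>2"
proof -
  define w where "w = (\<lambda>k. (pochhammer (1 / 2) k / fact k)\<^sup>2 * (2 * real k + 1))"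
  have "(\<lambda>k. 1 / (1 / w k)) \<longlonglongrightarrow> 1 / (pi / 2)"
    using tendsto_divide[OF tendsto_const[of 1] wallis]
    unfolding wallis_product_pochhammer w_def by simp
  hence w: "w \<longlonglongrightarrow> 2 / pi" by simp
  have "(\<lambda>k::nat. (8 * real k ^ 2 + 4 * real k + 1) / (2 * real k + 1)\<^sup>2) \<longlonglongrightarrow> 2"
    by real_asymp
  with w have "(\<lambda>k. w k ^ 2 * ((8 * real k ^ 2 + 4 * real k + 1) / (2 * real k + 1)\<^sup>2))
                 \<longlonglongrightarrow> (2 / pi)\<^sup>2 * 2"
    by (intro tendsto_mult tendsto_power)
  also have "(\<lambda>k. w k ^ 2 * ((8 * real k ^ 2 + 4 * real k + 1) / (2 * real k + 1)\<^sup>2))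
              = (\<lambda>k. wz_F 0 k)"
  proof
    fix k
    have "2 * real k + 1 \<noteq> 0" by linarith
    thus "w k ^ 2 * ((8 * real k ^ 2 + 4 * real k + 1) / (2 * real k + 1)\<^sup>2) = wz_F 0 k"
      by (simp add: w_def wz_F_def wz_kernel_def power_mult_distrib power_divide add_ac
               flip: power_mult)
  qed
  finally show ?thesis by (simp add: power_divide)
qed

theorem guillera_series: "(\<lambda>n. wz_F n 0) sums (8 / pi\<^sup>2)"
proof -
  have tail: "\<bar>\<Sum>n. wz_F (Suc n) k\<bar> \<le> 80 / (real k + 1)\<^sup>2" for k
  proof -
    have geo: "(\<lambda>n. 80 / (real k + 1)\<^sup>2 * (1 / 2) ^ Suc n) sums (80 / (real k + 1)\<^sup>2 * 1)"
      by (intro sums_mult power_half_series)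
    have "norm (\<Sum>n. wz_F (Suc n) k) \<le> (\<Sum>n. 80 / (real k + 1)\<^sup>2 * (1 / 2) ^ Suc n)"
      using wz_F_Suc_bound by (intro norm_suminf_le sums_summable[OF geo]) auto
    also have "\<dots> = 80 / (real k + 1)\<^sup>2"
      using geo by (simp add: sums_iff)
    finally show ?thesis by simp
  qed
  have "(\<lambda>k. \<Sum>n. wz_F (Suc n) k) \<longlonglongrightarrow> 0"
  proof (rule Lim_null_comparison)
    show "(\<lambda>k::nat. 80 / (real k + 1)\<^sup>2) \<longlonglongrightarrow> 0" by real_asymp
  qed (use tail in auto)
  hence "(\<lambda>k. wz_F 0 k + (\<Sum>n. wz_F (Suc n) k)) \<longlonglongrightarrow> 8 / pi\<^sup>2 + 0"
    by (intro tendsto_add wz_F_0_tendsto)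
  moreover have "wz_F 0 k + (\<Sum>n. wz_F (Suc n) k) = (\<Sum>n. wz_F n 0)" for k
    using suminf_split_head[OF summable_wz_F[of k]] suminf_wz_F[of k] by simp
  ultimately have "(\<Sum>n. wz_F n 0) = 8 / pi\<^sup>2"
    by (simp add: LIMSEQ_const_iff)
  with summable_wz_F[of 0] show ?thesis by (simp add: sums_iff)
qed

section \<open>The shifted series\<close>

text \<open>The two coefficients of the factor \<open>384 - 256 n\<close> come from matching the coefficients of
  \<open>n\<^sup>6\<close> and \<open>n\<^sup>0\<close>; the remaining five coefficients then agree as well.\<close>

lemma shifted_term:
  fixes h :: "nat \<Rightarrow> real"
  defines "h \<equiv> \<lambda>n. wz_kernel n 0 * (real n ^ 5 * (384 - 256 * real n))"
  shows "16 * (wz_kernel n 0 * real n ^ 4 * (20 * real n ^ 2 - 16 * real n + 5))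
           = wz_F n 0 + (h (Suc n) - h n)"
proof -
  define x where "x = real n"
  have nz: "x + 1 \<noteq> 0" unfolding x_def by linarith
  have "16 * (x ^ 4 * (20 * x\<^sup>2 - 16 * x + 5))
      = (20 * x\<^sup>2 + 8 * x + 1) + (- ((x + 1 / 2) ^ 5) / 4 * (384 - 256 * (x + 1))
          - x ^ 5 * (384 - 256 * x))"
    by algebra
  also have "- ((x + 1 / 2) ^ 5) / 4
      = - ((x + 1 / 2) ^ 5) / (4 * ((x + 1) * (x + 1) ^ 4)) * (x + 1) ^ 5"
    using nz by (simp add: divide_simps eval_nat_numeral)
  finally have "wz_kernel n 0 * (16 * (x ^ 4 * (20 * x\<^sup>2 - 16 * x + 5)))
      = wz_kernel n 0 * ((20 * x\<^sup>2 + 8 * x + 1)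
          + (- ((x + 1 / 2) ^ 5) / (4 * ((x + 1) * (x + 1) ^ 4)) * (x + 1) ^ 5 * (384 - 256 * (x + 1))
             - x ^ 5 * (384 - 256 * x)))" (is "_ * ?l = _ * (?p + (?r - ?s))")
    by (rule arg_cong)
  moreover have "16 * (wz_kernel n 0 * real n ^ 4 * (20 * real n ^ 2 - 16 * real n + 5))
      = wz_kernel n 0 * ?l"
    by (simp only: x_def mult.assoc mult.left_commute[of 16])
  moreover have "wz_F n 0 = wz_kernel n 0 * ?p" "h n = wz_kernel n 0 * ?s"
    by (simp_all add: wz_F_def h_def x_def)
  moreover have "h (Suc n) = wz_kernel n 0 * ?r"
    by (simp only: h_def wz_kernel_Suc_left x_def of_nat_Suc of_nat_0 add_0_right
          add.commute[of 1] mult.assoc)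
  ultimately show ?thesis
    by (simp only: distrib_left right_diff_distrib)
qed

lemma shifted_series:
  "(\<lambda>n. wz_kernel n 0 * real n ^ 4 * (20 * real n ^ 2 - 16 * real n + 5)) sums (1 / (2 * pi\<^sup>2))"
proof -
  define h where "h = (\<lambda>n. wz_kernel n 0 * (real n ^ 5 * (384 - 256 * real n)))"
  have "h \<longlonglongrightarrow> 0"
  proof (rule Lim_null_comparison)
    show "(\<lambda>n. (1 / 4) ^ n * \<bar>real n ^ 5 * (384 - 256 * real n)\<bar>) \<longlonglongrightarrow> 0"
      by real_asymp
    show "eventually (\<lambda>n. norm (h n) \<le> (1 / 4) ^ n * \<bar>real n ^ 5 * (384 - 256 * real n)\<bar>) sequentially"
      unfolding h_def real_norm_def abs_mult[of "wz_kernel _ _"]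
      by (intro always_eventually allI mult_right_mono wz_kernel_le_power) auto
  qed
  hence "(\<lambda>n. wz_F n 0 + (h (Suc n) - h n)) sums (8 / pi\<^sup>2 + (0 - h 0))"
    by (intro sums_add guillera_series telescope_sums)
  hence "(\<lambda>n. 16 * (wz_kernel n 0 * real n ^ 4 * (20 * real n ^ 2 - 16 * real n + 5)))
           sums (8 / pi\<^sup>2)"
    unfolding shifted_term h_def by simp
  hence "(\<lambda>n. 1 / 16 * (16 * (wz_kernel n 0 * real n ^ 4 * (20 * real n ^ 2 - 16 * real n + 5))))
           sums (1 / 16 * (8 / pi\<^sup>2))"
    by (rule sums_mult)
  thus ?thesis by simp
qed

theorem mainTheorem3:
  shows "(\<lambda>k::nat. (- (1 / 4) :: real) ^ k
            * (pochhammer (3 / 2) k ^ 5 / (pochhammer 1 k ^ 4 * pochhammer 2 k))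
            * (20 * real k ^ 2 + 24 * real k + 9))
         sums (- (64 / pi ^ 2))"
proof -
  define v where "v = (\<lambda>n. wz_kernel n 0 * real n ^ 4 * (20 * real n ^ 2 - 16 * real n + 5))"
  have "v sums (1 / (2 * pi\<^sup>2))"
    unfolding v_def by (rule shifted_series)
  \<comment> \<open>The factor \<open>n\<^sup>4\<close> makes the term at \<open>n = 0\<close> vanish, so dropping it does not change the sum.\<close>
  hence "(\<lambda>k. v (Suc k)) sums (1 / (2 * pi\<^sup>2))"
    by (subst sums_Suc_iff) (simp add: v_def)
  hence "(\<lambda>k. - 128 * v (Suc k)) sums (- 128 * (1 / (2 * pi\<^sup>2)))"
    by (rule sums_mult)
  moreover have "- 128 * v (Suc k) = (- (1 / 4) :: real) ^ k
            * (pochhammer (3 / 2) k ^ 5 / (pochhammer 1 k ^ 4 * pochhammer 2 k))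
            * (20 * real k ^ 2 + 24 * real k + 9)" for k
  proof -
    have half: "pochhammer (1 / 2) (Suc k) = pochhammer (3 / 2 :: real) k / 2"
      by (simp add: pochhammer_rec)
    have one: "pochhammer 1 k = (fact k :: real)"
      by (simp add: pochhammer_fact)
    have two: "pochhammer 2 k = (fact (Suc k) :: real)"
      using pochhammer_rec[of "1 :: real" k] by (simp add: pochhammer_fact)
    have poly: "20 * real (Suc k) ^ 2 - 16 * real (Suc k) + 5 = 20 * real k ^ 2 + 24 * real k + 9"
      by (simp add: power2_eq_square algebra_simps)
    have fac: "(fact (Suc k) :: real) = real (Suc k) * fact k" by simp
    show ?thesis
      unfolding v_def wz_kernel_def half one two poly add_0_right
      unfolding fac by (simp add: power_mult_distrib power_divide del: of_nat_Suc)
  qed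
  ultimately show ?thesis by simp
qed

end
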